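(* For all integers $n\ge 2$, $\ell_{\mathrm{hex}}(n)=L_{\mathrm{hex}}(n)$.
   Context: The hexagonal lattice is the tiling of the plane by regular hexagons; two hexagonal cells are adjacent iff they share an edge (so each cell has $6$ neighbours). A tree-like polyhex of size $n$ is a set of $n$ cells whose induced adjacency graph is a tree. A leaf of a tree $T$ is a vertex of degree $1$ in $T$; $n_1(T)$ denotes the number of leaves. For $n\ge 2$, $L_{\mathrm{hex}}(n)$ is the maximum of $n_1(T)$ over all tree-like polyhexes $T$ of size $n$. The function $\ell_{\mathrm{hex}}$ is defined for integers $n\ge2$ by $\ell_{\mathrm{hex}}(2)=\ell_{\mathrm{hex}}(3)=2$ and $\ell_{\mathrm{hex}}(n)=\ell_{\mathrm{hex}}(n-2)+1$ for $n\ge 4$; equivalently $\ell_{\mathrm{hex}}(n)=\lfloor n/2\rfloor+1$. *)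

theory Defs
  imports "HOL-Analysis.Analysis"
begin

section \<open>Finite simple graphs: trees and leaves\<close>

text \<open>
  The graphs below are given by a vertex set \<open>V\<close> and a symmetric irreflexive relation \<open>E\<close>; only the
  pairs of \<open>E\<close> with both members in \<open>V\<close> count, so this is the subgraph induced by \<open>V\<close>.
\<close>

definition gr_connected :: "'a set \<Rightarrow> ('a \<Rightarrow> 'a \<Rightarrow> bool) \<Rightarrow> bool" where
  "gr_connected V E \<longleftrightarrow>
     V \<noteq> {} \<and> (\<forall>u\<in>V. \<forall>v\<in>V. (u, v) \<in> {(x, y). x \<in> V \<and> y \<in> V \<and> E x y}\<^sup>*)"

definition gr_cycle :: "'a set \<Rightarrow> ('a \<Rightarrow> 'a \<Rightarrow> bool) \<Rightarrow> 'a list \<Rightarrow> bool" where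
  "gr_cycle V E xs \<longleftrightarrow>
     3 \<le> length xs \<and> distinct xs \<and> set xs \<subseteq> V \<and>
     (\<forall>i<length xs. E (xs ! i) (xs ! (Suc i mod length xs)))"

definition gr_tree :: "'a set \<Rightarrow> ('a \<Rightarrow> 'a \<Rightarrow> bool) \<Rightarrow> bool" where
  "gr_tree V E \<longleftrightarrow> gr_connected V E \<and> (\<nexists>xs. gr_cycle V E xs)"

definition gr_degree :: "'a set \<Rightarrow> ('a \<Rightarrow> 'a \<Rightarrow> bool) \<Rightarrow> 'a \<Rightarrow> nat" where
  "gr_degree V E v = card {w \<in> V. E v w}"

definition gr_leaves :: "'a set \<Rightarrow> ('a \<Rightarrow> 'a \<Rightarrow> bool) \<Rightarrow> 'a set" where
  "gr_leaves V E = {v \<in> V. gr_degree V E v = 1}"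


section \<open>The hexagonal lattice\<close>

text \<open>
  The plane is tiled by regular hexagons of side 1 whose centres form the lattice generated by
  \<open>sqrt 3\<close> and \<open>sqrt 3 * cis (pi / 3)\<close>.  A cell is represented by the coordinates \<open>(i, j)\<close> of its
  centre in this lattice.
\<close>

type_synonym hex_cell = "int \<times> int"

definition hex_centre :: "hex_cell \<Rightarrow> complex" where
  "hex_centre c = of_real (sqrt 3) * (of_int (fst c) + of_int (snd c) * cis (pi / 3))"

definition hex_vertex :: "hex_cell \<Rightarrow> nat \<Rightarrow> complex" where
  "hex_vertex c k = hex_centre c + cis (pi / 6 + real k * (pi / 3))"

definition hex_edges :: "hex_cell \<Rightarrow> complex set set" where
  "hex_edges c = {closed_segment (hex_vertex c k) (hex_vertex c (Suc k)) | k. k < 6}"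

definition hex_adj :: "hex_cell \<Rightarrow> hex_cell \<Rightarrow> bool" where
  "hex_adj c d \<longleftrightarrow> c \<noteq> d \<and> hex_edges c \<inter> hex_edges d \<noteq> {}"


section \<open>Tree-like polyhexes and their leaves\<close>

definition tree_like_polyhex :: "nat \<Rightarrow> hex_cell set \<Rightarrow> bool" where
  "tree_like_polyhex n T \<longleftrightarrow> finite T \<and> card T = n \<and> gr_tree T hex_adj"

definition num_leaves :: "hex_cell set \<Rightarrow> nat" where
  "num_leaves T = card (gr_leaves T hex_adj)"

definition L_hex :: "nat \<Rightarrow> nat" where
  "L_hex n = Max {num_leaves T | T. tree_like_polyhex n T}"

text \<open>Only the values at \<open>n \<ge> 2\<close> are meaningful.\<close>

fun l_hex :: "nat \<Rightarrow> nat" where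
  "l_hex n = (if n \<le> 3 then 2 else l_hex (n - 2) + 1)"

declare l_hex.simps [simp del]


section \<open>Consistency checks\<close>

lemma l_hex_closed_form: "2 \<le> n \<Longrightarrow> l_hex n = n div 2 + 1"
proof (induction n rule: less_induct)
  case (less n)
  show ?case
  proof (cases "n \<le> 3")
    case True
    with less.prems have "n div 2 = 1" by auto
    with True show ?thesis by (simp add: l_hex.simps[of n])
  next
    case False
    then have "l_hex (n - 2) = (n - 2) div 2 + 1" by (intro less.IH) auto
    with False show ?thesis by (subst l_hex.simps) auto
  qed
qed

text \<open>The maximum in \<open>L_hex\<close> is taken over a finite set.\<close>

lemma finite_num_leaves: "finite {num_leaves T | T. tree_like_polyhex n T}"
proof (rule finite_subset)
  show "{num_leaves T | T. tree_like_polyhex n T} \<subseteq> {..n}"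
    by (auto simp: tree_like_polyhex_def num_leaves_def gr_leaves_def intro!: card_mono)
qed simp

lemma hex_vertex_coords:
  "hex_vertex (i, j) 0 = Complex (sqrt 3 / 2 * of_int (2*i + j + 1)) (of_int (3*j + 1) / 2)"
  "hex_vertex (i, j) 1 = Complex (sqrt 3 / 2 * of_int (2*i + j)) (of_int (3*j + 2) / 2)"
  "hex_vertex (i, j) 2 = Complex (sqrt 3 / 2 * of_int (2*i + j - 1)) (of_int (3*j + 1) / 2)"
  "hex_vertex (i, j) 3 = Complex (sqrt 3 / 2 * of_int (2*i + j - 1)) (of_int (3*j - 1) / 2)"
  "hex_vertex (i, j) 4 = Complex (sqrt 3 / 2 * of_int (2*i + j)) (of_int (3*j - 2) / 2)"
  "hex_vertex (i, j) 5 = Complex (sqrt 3 / 2 * of_int (2*i + j + 1)) (of_int (3*j - 1) / 2)"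
  "hex_vertex (i, j) 6 = Complex (sqrt 3 / 2 * of_int (2*i + j + 1)) (of_int (3*j + 1) / 2)"
proof -
  have c0: "cis (pi/6 + real 0 * (pi/3)) = Complex (sqrt 3 / 2) (1/2)"
    by (simp add: complex_eq_iff cos_30 sin_30)
  have c1: "cis (pi/6 + real 1 * (pi/3)) = Complex 0 1"
  proof -
    have "pi/6 + real 1 * (pi/3) = pi/2" by simp
    then show ?thesis by (simp only:) (simp add: complex_eq_iff)
  qed
  have c2: "cis (pi/6 + real 2 * (pi/3)) = Complex (- (sqrt 3 / 2)) (1/2)"
  proof -
    have "pi/6 + real 2 * (pi/3) = pi - pi/6" by simp
    then have "cis (pi/6 + real 2 * (pi/3)) = Complex (- cos (pi/6)) (sin (pi/6))"
      by (simp only: cis.code cos_pi_minus sin_pi_minus)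
    then show ?thesis by (simp only: cos_30 sin_30)
  qed
  have shift: "cis (pi/6 + real (k + 3) * (pi/3)) = - cis (pi/6 + real k * (pi/3))" for k
  proof -
    have "pi/6 + real (k + 3) * (pi/3) = (pi/6 + real k * (pi/3)) + pi" by (simp add: field_simps)
    then show ?thesis by (simp only: cis.code cos_periodic_pi sin_periodic_pi complex_eq_iff
          complex.sel uminus_complex.sel)
  qed
  note c = c0 c1 c2 shift[of 0, unfolded c0] shift[of 1, unfolded c1] shift[of 2, unfolded c2]
  have c6: "cis (pi/6 + real 6 * (pi/3)) = Complex (sqrt 3 / 2) (1/2)"
    using shift[of 3] shift[of 0] c0 by simp
  have m: "Re (hex_centre (i, j)) = sqrt 3 / 2 * of_int (2*i + j)"
          "Im (hex_centre (i, j)) = of_int (3*j) / 2"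
    by (simp_all add: hex_centre_def cos_60 sin_60 field_simps)
  show "hex_vertex (i, j) 0 = Complex (sqrt 3 / 2 * of_int (2*i + j + 1)) (of_int (3*j + 1) / 2)"
    unfolding hex_vertex_def c(1) by (simp add: complex_eq_iff m field_simps)
  show "hex_vertex (i, j) 1 = Complex (sqrt 3 / 2 * of_int (2*i + j)) (of_int (3*j + 2) / 2)"
    unfolding hex_vertex_def c(2) by (simp add: complex_eq_iff m field_simps)
  show "hex_vertex (i, j) 2 = Complex (sqrt 3 / 2 * of_int (2*i + j - 1)) (of_int (3*j + 1) / 2)"
    unfolding hex_vertex_def c(3) by (simp add: complex_eq_iff m field_simps)
  show "hex_vertex (i, j) 3 = Complex (sqrt 3 / 2 * of_int (2*i + j - 1)) (of_int (3*j - 1) / 2)"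
    using c(4) unfolding hex_vertex_def by (simp add: complex_eq_iff m field_simps)
  show "hex_vertex (i, j) 4 = Complex (sqrt 3 / 2 * of_int (2*i + j)) (of_int (3*j - 2) / 2)"
    using c(5) unfolding hex_vertex_def by (simp add: complex_eq_iff m field_simps)
  show "hex_vertex (i, j) 5 = Complex (sqrt 3 / 2 * of_int (2*i + j + 1)) (of_int (3*j - 1) / 2)"
    using c(6) unfolding hex_vertex_def by (simp add: complex_eq_iff m field_simps)
  show "hex_vertex (i, j) 6 = Complex (sqrt 3 / 2 * of_int (2*i + j + 1)) (of_int (3*j + 1) / 2)"
    unfolding hex_vertex_def c6 by (simp add: complex_eq_iff m field_simps)
qed

definition hex_point :: "int \<Rightarrow> int \<Rightarrow> complex" where
  "hex_point a b = Complex (sqrt 3 / 2 * of_int a) (of_int b / 2)"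

lemma hex_point_eq_iff: "hex_point a b = hex_point a' b' \<longleftrightarrow> a = a' \<and> b = b'"
  by (simp add: hex_point_def)

lemma hex_edges_coords:
  "hex_edges (i, j) =
    {closed_segment (hex_point (2*i+j+1) (3*j+1)) (hex_point (2*i+j) (3*j+2)),
     closed_segment (hex_point (2*i+j) (3*j+2)) (hex_point (2*i+j-1) (3*j+1)),
     closed_segment (hex_point (2*i+j-1) (3*j+1)) (hex_point (2*i+j-1) (3*j-1)),
     closed_segment (hex_point (2*i+j-1) (3*j-1)) (hex_point (2*i+j) (3*j-2)),
     closed_segment (hex_point (2*i+j) (3*j-2)) (hex_point (2*i+j+1) (3*j-1)),
     closed_segment (hex_point (2*i+j+1) (3*j-1)) (hex_point (2*i+j+1) (3*j+1))}"
proof -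
  have "{f k | k. k < 6} = {f 0, f 1, f 2, f 3, f 4, f 5}" for f :: "nat \<Rightarrow> complex set"
  proof -
    have "{k::nat. k < 6} = {0, 1, 2, 3, 4, 5}" by auto
    then have "f ` {k. k < 6} = f ` {0, 1, 2, 3, 4, 5}" by simp
    then show ?thesis by (simp add: image_Collect)
  qed
  from this[of "\<lambda>k. closed_segment (hex_vertex (i, j) k) (hex_vertex (i, j) (Suc k))"]
  have "hex_edges (i, j) =
    {closed_segment (hex_vertex (i, j) 0) (hex_vertex (i, j) 1),
     closed_segment (hex_vertex (i, j) 1) (hex_vertex (i, j) 2),
     closed_segment (hex_vertex (i, j) 2) (hex_vertex (i, j) 3),
     closed_segment (hex_vertex (i, j) 3) (hex_vertex (i, j) 4),
     closed_segment (hex_vertex (i, j) 4) (hex_vertex (i, j) 5),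
     closed_segment (hex_vertex (i, j) 5) (hex_vertex (i, j) 6)}"
    unfolding hex_edges_def by (simp add: numeral_eq_Suc)
  then show ?thesis unfolding hex_vertex_coords hex_point_def .
qed

text \<open>Sharing an edge, in coordinates: each cell has exactly six neighbours.\<close>

lemma hex_adj_iff:
  "hex_adj (i, j) (i', j') \<longleftrightarrow>
     (i' - i, j' - j) \<in> {(1, 0), (0, 1), (-1, 1), (-1, 0), (0, -1), (1, -1)}"
proof -
  have meet: "A \<inter> B \<noteq> {} \<longleftrightarrow> (\<exists>e\<in>A. e \<in> B)" for A B :: "complex set set"
    by blast
  show ?thesis
    unfolding hex_adj_def hex_edges_coords meet
    by (simp add: doubleton_eq_iff hex_point_eq_iff) presburger
qed

end

theory Submission
  imports Defs
begin

text \<open>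
  Upper bound.  The six neighbours of a cell lie cyclically around it, consecutive ones being
  adjacent.  A tree contains no triangle, so at most one cell of each of three disjoint consecutive
  pairs is present: every cell of a tree-like polyhex has degree at most \<open>3\<close>
  (lemma \<open>tree_degree_le_3\<close>).  A connected graph on \<open>n\<close> vertices has degree sum at least
  \<open>2 * (n - 1)\<close> (lemma \<open>connected_degree_sum\<close>), whereas \<open>n\<^sub>1\<close> vertices of degree \<open>1\<close> and
  \<open>n - n\<^sub>1\<close> vertices of degree at most \<open>3\<close> have degree sum at most \<open>3 * n - 2 * n\<^sub>1\<close>.
  Hence \<open>2 * n\<^sub>1 \<le> n + 2\<close>.

  Lower bound.  Equality, up to rounding, requires that all cells, except at most one, have degree
  \<open>1\<close> or \<open>3\<close>.  This is achieved by a caterpillar: a zigzag row of cells in which each step turns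
  by sixty degrees, alternately to the left and to the right, so that at every inner cell of the row
  exactly one further cell can be attached, on the outer side of the bend, without closing a
  triangle.  The attached cells on either side of the row are too far apart to touch each other.
  Built cell by cell, each new cell meeting exactly one old one, the caterpillar is a tree
  (lemma \<open>gr_tree_insert\<close>).
\<close>

section \<open>Trees and degree sums\<close>

text \<open>
  On a cycle the new vertex would have two distinct neighbours, its predecessor and its successor.
\<close>

lemma gr_tree_insert:
  assumes sym: "\<And>x y. E x y \<Longrightarrow> E y x"
    and tree: "gr_tree V E" and new: "w \<notin> V" and nbr: "{v \<in> V. E w v} = {u}"
  shows "gr_tree (insert w V) E"
proof -
  let ?R = "{(x, y). x \<in> V \<and> y \<in> V \<and> E x y}"
  let ?R' = "{(x, y). x \<in> insert w V \<and> y \<in> insert w V \<and> E x y}"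
  have u: "u \<in> V" "E w u" using nbr by auto
  have conn: "gr_connected (insert w V) E"
  proof -
    have old: "(x, y) \<in> ?R'\<^sup>*" if "x \<in> V" "y \<in> V" for x y
    proof -
      have "(x, y) \<in> ?R\<^sup>*" using tree that by (auto simp: gr_tree_def gr_connected_def)
      moreover have "?R\<^sup>* \<subseteq> ?R'\<^sup>*" by (rule rtrancl_mono) auto
      ultimately show ?thesis by blast
    qed
    have wu: "(w, u) \<in> ?R'" "(u, w) \<in> ?R'" using u sym by auto
    have from_w: "(w, y) \<in> ?R'\<^sup>*" if "y \<in> V" for y
      using wu(1) old[OF u(1) that] by (rule converse_rtrancl_into_rtrancl)
    have to_w: "(y, w) \<in> ?R'\<^sup>*" if "y \<in> V" for y
      using old[OF that u(1)] wu(2) by (rule rtrancl_into_rtrancl)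
    show ?thesis unfolding gr_connected_def using old from_w to_w by blast
  qed
  have "\<not> gr_cycle (insert w V) E xs" for xs
  proof
    assume cyc: "gr_cycle (insert w V) E xs"
    let ?l = "length xs"
    from cyc have l: "3 \<le> ?l" and d: "distinct xs" and sub: "set xs \<subseteq> insert w V"
      and step: "\<And>i. i < ?l \<Longrightarrow> E (xs ! i) (xs ! (Suc i mod ?l))"
      by (auto simp: gr_cycle_def)
    show False
    proof (cases "w \<in> set xs")
      case False
      with cyc have "gr_cycle V E xs" by (auto simp: gr_cycle_def)
      with tree show False by (auto simp: gr_tree_def)
    next
      case True
      then obtain i where i: "i < ?l" "xs ! i = w" by (auto simp: in_set_conv_nth)
      define j where "j = (if i = 0 then ?l - 1 else i - 1)"
      define k where "k = Suc i mod ?l"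
      have jl: "j < ?l" using i by (auto simp: j_def)
      have kl: "k < ?l" unfolding k_def by (rule mod_less_divisor) (use l in linarith)
      have ji: "Suc j mod ?l = i" using i l by (auto simp: j_def)
      have k': "k = (if Suc i = ?l then 0 else Suc i)" using i by (auto simp: k_def)
      have "j \<noteq> i" "k \<noteq> i" "j \<noteq> k" using l i by (auto simp: j_def k' split: if_splits)
      then have ne: "xs ! j \<noteq> w" "xs ! k \<noteq> w" "xs ! j \<noteq> xs ! k"
        using d jl kl i by (auto simp: nth_eq_iff_index_eq)
      have "E (xs ! j) w" "E w (xs ! k)"
        using step[OF jl] step[OF i(1)] ji i(2) by (simp_all add: k_def)
      then have "xs ! j \<in> {v \<in> V. E w v}" "xs ! k \<in> {v \<in> V. E w v}"
        using sub ne jl kl sym by (auto dest: nth_mem)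
      with nbr ne show False by auto
    qed
  qed
  with conn show ?thesis by (simp add: gr_tree_def)
qed

text \<open>
  Without an edge that leaves \<open>U\<close>, no vertex outside \<open>U\<close> would be reachable from \<open>U\<close>.
\<close>

lemma connected_boundary_edge:
  assumes "gr_connected V E" "U \<subseteq> V" "U \<noteq> {}" "U \<noteq> V"
  obtains u w where "u \<in> U" "w \<in> V - U" "E u w"
proof -
  let ?R = "{(x, y). x \<in> V \<and> y \<in> V \<and> E x y}"
  obtain a b where ab: "a \<in> U" "b \<in> V - U" using assms by blast
  with assms have "(a, b) \<in> ?R\<^sup>*" by (auto simp: gr_connected_def)
  moreover have "(a, y) \<in> ?R\<^sup>* \<Longrightarrow> (\<exists>u\<in>U. \<exists>w\<in>V - U. E u w) \<or> y \<in> U" for y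
    by (induction rule: rtrancl_induct) (use ab in auto)
  ultimately show thesis using ab that by blast
qed

text \<open>
  A connected vertex set can be exhausted one vertex at a time along edges, and each vertex after
  the first brings at least one edge, that is, two ordered pairs of adjacent vertices.
\<close>

lemma connected_degree_sum:
  assumes sym: "\<And>x y. E x y \<Longrightarrow> E y x"
    and conn: "gr_connected V E" and fin: "finite V"
  shows "2 * card V \<le> (\<Sum>v\<in>V. gr_degree V E v) + 2"
proof -
  define P where "P U = {(x, y). x \<in> U \<and> y \<in> U \<and> E x y}" for U
  have finP: "finite (P U)" if "U \<subseteq> V" for U
  proof (rule finite_subset)
    show "P U \<subseteq> V \<times> V" using that by (auto simp: P_def)
  qed (use fin in simp)
  have "\<exists>U\<subseteq>V. card U = k \<and> 2 * k \<le> card (P U) + 2" if "1 \<le> k" "k \<le> card V" for k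
    using that
  proof (induction k rule: dec_induct)
    case base
    from conn obtain v where "v \<in> V" by (auto simp: gr_connected_def)
    then show ?case by (intro exI[of _ "{v}"]) auto
  next
    case (step k)
    then obtain U where U: "U \<subseteq> V" "card U = k" "2 * k \<le> card (P U) + 2" by auto
    have "U \<noteq> {}" "U \<noteq> V" using step U by auto
    then obtain u w where uw: "u \<in> U" "w \<in> V - U" "E u w"
      using connected_boundary_edge[OF conn U(1)] by metis
    have "card (insert (u, w) (insert (w, u) (P U))) \<le> card (P (insert w U))"
    proof (rule card_mono)
      show "finite (P (insert w U))" using finP uw U(1) by simp
    qed (use uw sym in \<open>auto simp: P_def\<close>)
    moreover have "card (insert (u, w) (insert (w, u) (P U))) = card (P U) + 2"
    proof -
      have "(w, u) \<notin> P U" "(u, w) \<notin> insert (w, u) (P U)" using uw by (auto simp: P_def)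
      then show ?thesis using finP[OF U(1)] by simp
    qed
    moreover have "card (insert w U) = Suc k"
      using U uw fin by (simp add: finite_subset[OF U(1)])
    ultimately show ?case using U uw by (intro exI[of _ "insert w U"]) auto
  qed
  moreover have "1 \<le> card V"
    using conn fin by (auto simp: gr_connected_def Suc_le_eq card_gt_0_iff)
  ultimately obtain U where U: "U \<subseteq> V" "card U = card V" "2 * card V \<le> card (P U) + 2"
    by blast
  then have "U = V" using card_subset_eq[OF fin] by blast
  moreover have "card (P V) = (\<Sum>v\<in>V. gr_degree V E v)"
  proof -
    have "P V = (SIGMA v:V. {w \<in> V. E v w})" by (auto simp: P_def)
    then show ?thesis using fin by (simp add: gr_degree_def)
  qed
  ultimately show ?thesis using U(3) by simp
qed


section \<open>The upper bound\<close>

lemma hex_adj_sym: "hex_adj c d \<Longrightarrow> hex_adj d c"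
  by (auto simp: hex_adj_def)

lemma tree_no_triangle:
  assumes "gr_tree V E" "a \<in> V" "b \<in> V" "c \<in> V" "E a b" "E b c" "E c a" "distinct [a, b, c]"
  shows False
proof -
  have "gr_cycle V E [a, b, c]"
    unfolding gr_cycle_def
  proof (intro conjI allI impI)
    fix i assume "i < length [a, b, c]"
    then consider "i = 0" | "i = 1" | "i = 2" by force
    then show "E ([a, b, c] ! i) ([a, b, c] ! (Suc i mod length [a, b, c]))"
      by cases (use assms(5-7) in simp_all)
  qed (use assms(2-4,8) in simp_all)
  with assms(1) show False by (auto simp: gr_tree_def)
qed

text \<open>
  The six neighbours are listed in cyclic order, paired into three pairs of adjacent cells.  Both
  cells of a pair would form a triangle with the centre.
\<close>

lemma tree_degree_le_3:
  assumes tree: "gr_tree T hex_adj" and v: "v \<in> T"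
  shows "gr_degree T hex_adj v \<le> 3"
proof -
  obtain i j where ij: "v = (i, j)" by (cases v)
  let ?A = "{(i+1, j), (i, j+1)}" and ?B = "{(i-1, j+1), (i-1, j)}" and ?C = "{(i, j-1), (i+1, j-1)}"
  have one: "card (T \<inter> {c, d}) \<le> 1" if "hex_adj v c" "hex_adj c d" "hex_adj d v" for c d
  proof -
    have "\<not> (c \<in> T \<and> d \<in> T)"
      using tree_no_triangle[OF tree v, of c d] that by (auto simp: hex_adj_def)
    then have "T \<inter> {c, d} \<subseteq> {c} \<or> T \<inter> {c, d} \<subseteq> {d}" by auto
    then show ?thesis by (auto dest: card_mono[rotated])
  qed
  have "card (T \<inter> ?A) \<le> 1" "card (T \<inter> ?B) \<le> 1" "card (T \<inter> ?C) \<le> 1"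
    by (rule one; simp add: ij hex_adj_iff)+
  then have "card (T \<inter> ?A \<union> T \<inter> ?B \<union> T \<inter> ?C) \<le> 3"
    using card_Un_le[of "T \<inter> ?A \<union> T \<inter> ?B" "T \<inter> ?C"] card_Un_le[of "T \<inter> ?A" "T \<inter> ?B"]
    by linarith
  moreover have "{w \<in> T. hex_adj v w} \<subseteq> T \<inter> ?A \<union> T \<inter> ?B \<union> T \<inter> ?C"
  proof
    fix w assume "w \<in> {w \<in> T. hex_adj v w}"
    then have "w \<in> T" and "hex_adj (i, j) (fst w, snd w)" by (simp_all add: ij)
    then have d: "(fst w - i, snd w - j) \<in> {(1, 0), (0, 1), (-1, 1), (-1, 0), (0, -1), (1, -1)}"
      unfolding hex_adj_iff by blast
    have "(i + p, j + q) \<in> ?A \<union> ?B \<union> ?C"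
      if "(p, q) \<in> {(1, 0), (0, 1), (-1, 1), (-1, 0), (0, -1), (1, -1)}" for p q
      using that by (elim insertE; simp)
    from this[OF d] have "w \<in> ?A \<union> ?B \<union> ?C" by simp
    with \<open>w \<in> T\<close> show "w \<in> T \<inter> ?A \<union> T \<inter> ?B \<union> T \<inter> ?C" by blast
  qed
  then have "gr_degree T hex_adj v \<le> card (T \<inter> ?A \<union> T \<inter> ?B \<union> T \<inter> ?C)"
    unfolding gr_degree_def by (rule card_mono[rotated]) simp
  ultimately show ?thesis by linarith
qed

lemma num_leaves_le:
  assumes "tree_like_polyhex n T"
  shows "num_leaves T \<le> n div 2 + 1"
proof -
  let ?L = "gr_leaves T hex_adj" and ?d = "gr_degree T hex_adj"
  from assms have fin: "finite T" and n: "card T = n" and tree: "gr_tree T hex_adj"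
    by (auto simp: tree_like_polyhex_def)
  from tree have conn: "gr_connected T hex_adj" by (simp add: gr_tree_def)
  have L: "?L \<subseteq> T" by (auto simp: gr_leaves_def)
  have "2 * n \<le> (\<Sum>v\<in>T. ?d v) + 2"
    using connected_degree_sum[of hex_adj T, OF hex_adj_sym conn fin] n by simp
  moreover have "(\<Sum>v\<in>T. ?d v) + 2 * num_leaves T \<le> 3 * n"
  proof -
    have "(\<Sum>v\<in>T. if v \<in> ?L then 2 else 0) = 2 * num_leaves T"
      using fin L by (simp add: num_leaves_def Int_absorb1 flip: sum.inter_restrict)
    then have "(\<Sum>v\<in>T. ?d v) + 2 * num_leaves T
        = (\<Sum>v\<in>T. ?d v + (if v \<in> ?L then 2 else 0))"
      by (simp only: sum.distrib)
    also have "\<dots> \<le> (\<Sum>v\<in>T. 3)"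
      by (rule sum_mono) (use tree_degree_le_3[OF tree] in \<open>auto simp: gr_leaves_def\<close>)
    finally show ?thesis using n by simp
  qed
  ultimately show ?thesis by linarith
qed


section \<open>The caterpillar\<close>

text \<open>
  The zigzag row runs along the diagonal: its \<open>i\<close>-th cell is the one with coordinate sum \<open>i\<close> and
  coordinate difference \<open>0\<close> or \<open>1\<close>.
\<close>

definition spine :: "nat \<Rightarrow> hex_cell" where
  "spine i = (int (Suc i div 2), int (i div 2))"

text \<open>
  Around \<open>spine i\<close>, the cell \<open>pendant i\<close> and the two neighbours in the zigzag row lie at angles of
  120 degrees from each other, so that no two of them touch.  Again the coordinate sum is \<open>i\<close>; the coordinate
  difference is \<open>-2\<close> on one side of the row and \<open>3\<close> on the other.
\<close>

definition pendant :: "nat \<Rightarrow> hex_cell" where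
  "pendant i = (if even i then (int (i div 2) - 1, int (i div 2) + 1)
                else (int (i div 2) + 2, int (i div 2) - 1))"

lemma spine_parity: "spine (2 * k) = (int k, int k)" "spine (Suc (2 * k)) = (int k + 1, int k)"
  by (simp_all add: spine_def)

lemma pendant_parity:
  "pendant (2 * k) = (int k - 1, int k + 1)" "pendant (Suc (2 * k)) = (int k + 2, int k - 1)"
  by (simp_all add: pendant_def)

lemma nat_parity_cases:
  obtains k where "n = 2 * k" | k where "n = Suc (2 * k)"
  by (metis evenE oddE Suc_eq_plus1)

lemma spine_eq_iff: "spine i = spine j \<longleftrightarrow> i = j"
  by (cases i rule: nat_parity_cases; cases j rule: nat_parity_cases;
      simp (no_asm_simp) add: spine_parity;
      (intro iffI)?; (elim disjE conjE)?; presburger)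

lemma pendant_eq_iff: "pendant i = pendant j \<longleftrightarrow> i = j"
  by (cases i rule: nat_parity_cases; cases j rule: nat_parity_cases;
      simp (no_asm_simp) add: pendant_parity;
      (intro iffI)?; (elim disjE conjE)?; presburger)

lemma spine_neq_pendant: "spine i \<noteq> pendant j"
  by (cases i rule: nat_parity_cases; cases j rule: nat_parity_cases;
      simp (no_asm_simp) add: spine_parity pendant_parity;
      (intro iffI)?; (elim disjE conjE)?; presburger)

lemma hex_adj_spine_spine: "hex_adj (spine i) (spine j) \<longleftrightarrow> j = Suc i \<or> i = Suc j"
  by (cases i rule: nat_parity_cases; cases j rule: nat_parity_cases;
      simp (no_asm_simp) add: spine_parity hex_adj_iff;
      (intro iffI)?; (elim disjE conjE)?; presburger)

lemma hex_adj_spine_pendant: "hex_adj (spine i) (pendant j) \<longleftrightarrow> i = j"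
  by (cases i rule: nat_parity_cases; cases j rule: nat_parity_cases;
      simp (no_asm_simp) add: spine_parity pendant_parity hex_adj_iff;
      (intro iffI)?; (elim disjE conjE)?; presburger)

lemma not_hex_adj_pendant_pendant: "\<not> hex_adj (pendant i) (pendant j)"
  by (cases i rule: nat_parity_cases; cases j rule: nat_parity_cases;
      simp (no_asm_simp) add: pendant_parity hex_adj_iff;
      (intro iffI)?; (elim disjE conjE)?; presburger)

lemma hex_adj_pendant_spine: "hex_adj (pendant i) (spine j) \<longleftrightarrow> i = j"
  by (metis hex_adj_spine_pendant hex_adj_sym)

lemmas caterpillar_simps =
  spine_eq_iff pendant_eq_iff spine_neq_pendant spine_neq_pendant[symmetric]
  hex_adj_spine_spine hex_adj_spine_pendant hex_adj_pendant_spine not_hex_adj_pendant_pendant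

text \<open>
  The first cell of the row carries no pendant cell, and for \<open>b < a\<close> neither does the last one: these
  two cells serve as leaves themselves.
\<close>

definition caterpillar :: "nat \<Rightarrow> nat \<Rightarrow> hex_cell set" where
  "caterpillar a b = spine ` {0..a} \<union> pendant ` {1..b}"

lemma tree_like_polyhex_insert:
  assumes "tree_like_polyhex n T" "w \<notin> T" "{v \<in> T. hex_adj w v} = {u}"
  shows "tree_like_polyhex (Suc n) (insert w T)"
  using assms gr_tree_insert[of hex_adj T w u, OF hex_adj_sym] by (auto simp: tree_like_polyhex_def)

lemma tree_like_polyhex_singleton: "tree_like_polyhex 1 {c}"
proof -
  have "\<not> gr_cycle {c} hex_adj xs" for xs
  proof
    assume cyc: "gr_cycle {c} hex_adj xs"
    then have "card (set xs) \<le> card {c}" by (intro card_mono) (auto simp: gr_cycle_def)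
    with cyc show False by (auto simp: gr_cycle_def distinct_card)
  qed
  then show ?thesis
    by (auto simp: tree_like_polyhex_def gr_tree_def gr_connected_def)
qed

lemma tree_like_polyhex_caterpillar:
  "b \<le> a \<Longrightarrow> tree_like_polyhex (Suc (a + b)) (caterpillar a b)"
proof (induction b)
  case 0
  show ?case
  proof (induction a)
    case 0
    show ?case using tree_like_polyhex_singleton by (simp add: caterpillar_def)
  next
    case (Suc a)
    have "caterpillar (Suc a) 0 = insert (spine (Suc a)) (caterpillar a 0)"
      by (auto simp: caterpillar_def atLeastAtMostSuc_conv)
    moreover have "tree_like_polyhex (Suc (Suc (a + 0))) (insert (spine (Suc a)) (caterpillar a 0))"
      by (rule tree_like_polyhex_insert[OF Suc, of _ "spine a"])
        (auto simp: caterpillar_def caterpillar_simps)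
    ultimately show ?case by simp
  qed
next
  case (Suc b)
  then have "tree_like_polyhex (Suc (a + b)) (caterpillar a b)" by simp
  then have "tree_like_polyhex (Suc (Suc (a + b))) (insert (pendant (Suc b)) (caterpillar a b))"
    by (rule tree_like_polyhex_insert[of _ _ _ "spine (Suc b)"])
      (use Suc.prems in \<open>auto simp: caterpillar_def caterpillar_simps\<close>)
  moreover have "caterpillar a (Suc b) = insert (pendant (Suc b)) (caterpillar a b)"
    by (auto simp: caterpillar_def atLeastAtMostSuc_conv)
  ultimately show ?case by simp
qed

lemma num_leaves_caterpillar:
  assumes "b < a"
  shows "b + 2 \<le> num_leaves (caterpillar a b)"
proof -
  let ?T = "caterpillar a b"
  let ?L = "insert (spine 0) (insert (spine a) (pendant ` {1..b}))"
  have leaf: "v \<in> gr_leaves ?T hex_adj" if "v \<in> ?T" "{w \<in> ?T. hex_adj v w} = {u}" for u v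
    using that by (simp add: gr_leaves_def gr_degree_def)
  have "spine 0 \<in> gr_leaves ?T hex_adj"
    by (rule leaf[of _ "spine 1"]) (use assms in \<open>auto simp: caterpillar_def caterpillar_simps\<close>)
  moreover have "spine a \<in> gr_leaves ?T hex_adj"
    by (rule leaf[of _ "spine (a - 1)"])
      (use assms in \<open>auto simp: caterpillar_def caterpillar_simps\<close>)
  moreover have "pendant i \<in> gr_leaves ?T hex_adj" if "i \<in> {1..b}" for i
    by (rule leaf[of _ "spine i"])
      (use assms that in \<open>auto simp: caterpillar_def caterpillar_simps\<close>)
  ultimately have "?L \<subseteq> gr_leaves ?T hex_adj" by auto
  moreover have "finite (gr_leaves ?T hex_adj)" by (simp add: gr_leaves_def caterpillar_def)
  ultimately have "card ?L \<le> num_leaves ?T" unfolding num_leaves_def by (rule card_mono[rotated])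
  moreover have "card ?L = b + 2"
  proof -
    have "inj_on pendant {1..b}" by (auto simp: inj_on_def caterpillar_simps)
    then have "card (pendant ` {1..b}) = b" by (simp add: card_image)
    moreover have "spine a \<notin> pendant ` {1..b}" "spine 0 \<notin> insert (spine a) (pendant ` {1..b})"
      using assms by (auto simp: caterpillar_simps)
    ultimately show ?thesis by simp
  qed
  ultimately show ?thesis by simp
qed

theorem theorem4p1:
  fixes n :: nat
  assumes "2 \<le> n"
  shows "l_hex n = L_hex n"
proof -
  \<comment> \<open>All inner cells of the row carry a pendant cell, except the last inner one if \<open>n\<close> is odd.\<close>
  define b where "b = n div 2 - 1"
  define a where "a = n - 1 - b"
  have ab: "b < a" "Suc (a + b) = n" "b + 2 = n div 2 + 1"
    using assms by (auto simp: a_def b_def)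
  have tree: "tree_like_polyhex n (caterpillar a b)"
    using tree_like_polyhex_caterpillar[of b a] ab by simp
  have "num_leaves (caterpillar a b) = n div 2 + 1"
    using num_leaves_le[OF tree] num_leaves_caterpillar[OF ab(1)] ab(3) by simp
  then have "n div 2 + 1 = num_leaves (caterpillar a b)" by (rule sym)
  with tree have attained: "n div 2 + 1 \<in> {num_leaves T | T. tree_like_polyhex n T}"
    by blast
  have "L_hex n = n div 2 + 1"
    unfolding L_hex_def
  proof (rule Max_eqI[OF finite_num_leaves _ attained])
    fix k assume "k \<in> {num_leaves T | T. tree_like_polyhex n T}"
    then show "k \<le> n div 2 + 1" using num_leaves_le by blast
  qed
  then show ?thesis using l_hex_closed_form[OF assms] by (rule trans[OF _ sym, rotated])
qed

end
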